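(* Let $n_0\in\mathbb{N}$ and let $x_1,\dots,x_{n_0},y$ be distinct commuting indeterminates over $\mathbb{C}$. Then the symmetric subalgebra $\mathcal{S}_{x_1,\dots,x_{n_0}}$ is algebra-monomorphic to the symmetric subalgebra $\mathcal{S}_{x_1,\dots,x_{n_0},y}$; that is, there is an injective algebra homomorphism $$\mathcal{S}_{x_1,\dots,x_{n_0}}\hookrightarrow\mathcal{S}_{x_1,\dots,x_{n_0},y}.$$
   Context: For distinct commuting indeterminates $z_1,\dots,z_m$, $\mathcal{S}_{z_1,\dots,z_m}$ is the subalgebra of $\mathbb{C}[z_1,\dots,z_m]$ consisting of symmetric polynomials (invariant under all permutations of $z_1,\dots,z_m$). *)

theory Defs
  imports Complex_Main "HOL-Library.FuncSet" "HOL-Library.Poly_Mapping" "HOL-Combinatorics.Permutations"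
begin

text \<open>
  Polynomials over the complex numbers with indeterminates named by the elements of \<open>'v\<close>:
  finitely supported maps from monomials (finitely supported exponent vectors) to
  coefficients.  Addition and multiplication are those of \<open>HOL-Library.Poly_Mapping\<close>,
  where multiplication is the convolution product.
\<close>

type_synonym 'v cpoly = "('v \<Rightarrow>\<^sub>0 nat) \<Rightarrow>\<^sub>0 complex"

definition indet :: "'v \<Rightarrow> 'v cpoly" where
  "indet z = Poly_Mapping.single (Poly_Mapping.single z 1) 1"

definition const :: "complex \<Rightarrow> 'v cpoly" where
  "const c = Poly_Mapping.single 0 c"

definition scale :: "complex \<Rightarrow> 'v cpoly \<Rightarrow> 'v cpoly" where
  "scale c p = const c * p"

definition polynomials_in :: "'v set \<Rightarrow> 'v cpoly set" where
  "polynomials_in Z = {p. \<forall>m \<in> Poly_Mapping.keys p. Poly_Mapping.keys m \<subseteq> Z}"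

definition subst :: "('v \<Rightarrow> 'v cpoly) \<Rightarrow> 'v cpoly \<Rightarrow> 'v cpoly" where
  "subst g p = (\<Sum>m \<in> Poly_Mapping.keys p.
     scale (Poly_Mapping.lookup p m)
       (\<Prod>z \<in> Poly_Mapping.keys m. g z ^ Poly_Mapping.lookup m z))"

definition sym_polynomials :: "'v set \<Rightarrow> 'v cpoly set" where
  "sym_polynomials Z = {p \<in> polynomials_in Z.
     \<forall>\<sigma>. \<sigma> permutes Z \<longrightarrow> subst (\<lambda>z. indet (\<sigma> z)) p = p}"

text \<open>
  Homomorphisms of unital complex algebras between subalgebras \<open>A\<close> and \<open>B\<close>;
  values of \<open>f\<close> outside \<open>A\<close> are irrelevant.
\<close>

definition algebra_hom_on :: "'v cpoly set \<Rightarrow> 'v cpoly set \<Rightarrow> ('v cpoly \<Rightarrow> 'v cpoly) \<Rightarrow> bool" where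
  "algebra_hom_on A B f \<longleftrightarrow>
     f \<in> A \<rightarrow> B \<and>
     f 1 = 1 \<and>
     (\<forall>p\<in>A. \<forall>q\<in>A. f (p + q) = f p + f q) \<and>
     (\<forall>p\<in>A. \<forall>q\<in>A. f (p * q) = f p * f q) \<and>
     (\<forall>c. \<forall>p\<in>A. f (scale c p) = scale c (f p))"

definition algebra_monomorphic :: "'v cpoly set \<Rightarrow> 'v cpoly set \<Rightarrow> bool" where
  "algebra_monomorphic A B \<longleftrightarrow> (\<exists>f. algebra_hom_on A B f \<and> inj_on f A)"

end

theory Submission
  imports Defs "HOL-Computational_Algebra.Fundamental_Theorem_Algebra"
begin

text \<open>
  It suffices to find algebraically independent symmetric polynomials \<open>g z\<close> in the larger set of
  indeterminates, one for each \<open>z\<close> in the smaller set: substituting them for the indeterminates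
  embeds the whole polynomial algebra, hence also its symmetric subalgebra.  We take the values
  \<open>g z = (\<Prod>w. h z - w)\<close> of the monic polynomial with generic roots at distinct points \<open>h z\<close>.
  By Lagrange interpolation and the fundamental theorem of algebra, these can be specialised to
  arbitrary complex values, so a polynomial relation between them vanishes identically.
\<close>

section \<open>Substitution is an algebra homomorphism\<close>

text \<open>The target is an arbitrary commutative semiring, so that the same monomial map serves
  both substitution of polynomials and evaluation at complex points.\<close>

definition mon :: "('v \<Rightarrow> 'b::comm_semiring_1) \<Rightarrow> ('v \<Rightarrow>\<^sub>0 nat) \<Rightarrow> 'b" where
  "mon g m = (\<Prod>z \<in> Poly_Mapping.keys m. g z ^ Poly_Mapping.lookup m z)"

lemma mon_superset:
  assumes "finite Z" "Poly_Mapping.keys m \<subseteq> Z"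
  shows "mon g m = (\<Prod>z \<in> Z. g z ^ Poly_Mapping.lookup m z)"
  unfolding mon_def
  by (rule prod.mono_neutral_left) (use assms in \<open>auto simp: in_keys_iff\<close>)

lemma mon_0 [simp]: "mon g 0 = 1"
  by (simp add: mon_def)

lemma mon_single [simp]: "mon g (Poly_Mapping.single z k) = g z ^ k"
  by (cases "k = 0") (auto simp: mon_def)

lemma mon_add: "mon g (m + n) = mon g m * mon g n"
proof -
  let ?Z = "Poly_Mapping.keys m \<union> Poly_Mapping.keys n"
  have "mon g (m + n) = (\<Prod>z \<in> ?Z. g z ^ Poly_Mapping.lookup (m + n) z)"
    by (rule mon_superset) (auto dest: subsetD[OF Poly_Mapping.keys_add])
  also have "\<dots> = mon g m * mon g n"
    by (simp add: mon_superset[of ?Z] lookup_add power_add prod.distrib)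
  finally show ?thesis .
qed

lemma const_0 [simp]: "const 0 = 0"
  and const_1 [simp]: "const 1 = 1"
  and const_add: "const (a + b) = const a + const b"
  and const_diff: "const (a - b) = const a - const b"
  and const_mult: "const (a * b) = const a * const b"
  by (simp_all add: const_def single_add single_diff mult_single)

lemma const_power: "const (a ^ n) = const a ^ n"
  by (induction n) (simp_all add: const_mult)

lemma const_sum: "const (sum f A) = (\<Sum>x\<in>A. const (f x))"
  by (induction A rule: infinite_finite_induct) (simp_all add: const_add)

lemma const_prod: "const (prod f A) = (\<Prod>x\<in>A. const (f x))"
  by (induction A rule: infinite_finite_induct) (simp_all add: const_mult)

lemma const_eq_0_iff [simp]: "const a = 0 \<longleftrightarrow> a = 0"
  by (metis const_0 const_def lookup_single_eq)

lemma subst_eq_mon: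
  "subst g p = (\<Sum>m \<in> Poly_Mapping.keys p. const (Poly_Mapping.lookup p m) * mon g m)"
  by (simp add: subst_def scale_def mon_def)

lemma subst_superset:
  assumes "finite M" "Poly_Mapping.keys p \<subseteq> M"
  shows "subst g p = (\<Sum>m \<in> M. const (Poly_Mapping.lookup p m) * mon g m)"
  unfolding subst_eq_mon
  by (rule sum.mono_neutral_left) (use assms in \<open>auto simp: in_keys_iff\<close>)

lemma subst_single: "subst g (Poly_Mapping.single m c) = const c * mon g m"
  by (cases "c = 0") (auto simp: subst_eq_mon)

lemma subst_0 [simp]: "subst g 0 = 0"
  by (simp add: subst_def)

lemma subst_const [simp]: "subst g (const c) = const c"
  by (simp add: const_def subst_single mult_single)

lemma subst_1 [simp]: "subst g 1 = 1"
  using subst_const[of g 1] by simp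

lemma subst_indet [simp]: "subst g (indet z) = g z"
  by (simp add: indet_def subst_single)

lemma subst_add: "subst g (p + q) = subst g p + subst g q"
proof -
  let ?M = "Poly_Mapping.keys p \<union> Poly_Mapping.keys q"
  have "subst g (p + q) = (\<Sum>m \<in> ?M. const (Poly_Mapping.lookup (p + q) m) * mon g m)"
    by (rule subst_superset) (auto dest: subsetD[OF Poly_Mapping.keys_add])
  also have "\<dots> = subst g p + subst g q"
    by (simp add: subst_superset[of ?M] lookup_add const_add distrib_right sum.distrib)
  finally show ?thesis .
qed

lemma subst_diff: "subst g (p - q) = subst g p - subst g q"
  using subst_add[of g "p - q" q] by simp

lemma subst_sum: "subst g (sum f A) = (\<Sum>x\<in>A. subst g (f x))"
  by (induction A rule: infinite_finite_induct) (simp_all add: subst_add)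

lemma cpoly_eq_sum_single:
  "p = (\<Sum>m \<in> Poly_Mapping.keys p. Poly_Mapping.single m (Poly_Mapping.lookup p m))"
  for p :: "'v cpoly"
  by (rule poly_mapping_eqI)
    (auto simp: lookup_sum lookup_single when_def in_keys_iff sum.delta)

text \<open>Expanding both factors into single terms reduces multiplicativity to
  \<open>mon_add\<close>.\<close>

lemma subst_mult: "subst g (p * q) = subst g p * subst g q"
proof -
  let ?s = "\<lambda>r m. Poly_Mapping.single m (Poly_Mapping.lookup r m)"
  have "p * q = (\<Sum>m \<in> Poly_Mapping.keys p. ?s p m) * (\<Sum>n \<in> Poly_Mapping.keys q. ?s q n)"
    using cpoly_eq_sum_single[of p] cpoly_eq_sum_single[of q] by simp
  also have "subst g \<dots> = subst g p * subst g q"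
    by (simp add: sum_product subst_sum mult_single subst_single const_mult mon_add
        subst_eq_mon[of g p] subst_eq_mon[of g q] mult_ac)
  finally show ?thesis .
qed

lemma subst_power: "subst g (p ^ n) = subst g p ^ n"
  by (induction n) (simp_all add: subst_mult)

lemma subst_prod: "subst g (prod f A) = (\<Prod>x\<in>A. subst g (f x))"
  by (induction A rule: infinite_finite_induct) (simp_all add: subst_mult)

lemma subst_scale: "subst g (scale c p) = scale c (subst g p)"
  by (simp add: scale_def subst_mult)

lemma subst_subst: "subst h (subst g p) = subst (\<lambda>z. subst h (g z)) p"
  by (simp add: subst_eq_mon[of g p] subst_eq_mon[of _ p] subst_sum subst_mult
      mon_def subst_prod subst_power)

lemma subst_cong:
  assumes "p \<in> polynomials_in Z" "\<And>z. z \<in> Z \<Longrightarrow> f z = g z"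
  shows "subst f p = subst g p"
proof -
  have "mon f m = mon g m" if "m \<in> Poly_Mapping.keys p" for m
    unfolding mon_def using assms that
    by (intro prod.cong refl arg_cong2[where f = "(^)"]) (auto simp: polynomials_in_def)
  then show ?thesis
    by (simp add: subst_eq_mon)
qed

section \<open>Closure properties of polynomials in given indeterminates\<close>

lemma polynomials_in_const [simp]: "const c \<in> polynomials_in Z"
  by (auto simp: polynomials_in_def const_def)

lemma polynomials_in_0 [simp]: "0 \<in> polynomials_in Z"
  and polynomials_in_1 [simp]: "1 \<in> polynomials_in Z"
  using polynomials_in_const[of 0] polynomials_in_const[of 1] by simp_all

lemma polynomials_in_indet: "z \<in> Z \<Longrightarrow> indet z \<in> polynomials_in Z"
  by (auto simp: polynomials_in_def indet_def)

lemma polynomials_in_add: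
  "p \<in> polynomials_in Z \<Longrightarrow> q \<in> polynomials_in Z \<Longrightarrow> p + q \<in> polynomials_in Z"
  using Poly_Mapping.keys_add[of p q] by (fastforce simp: polynomials_in_def)

lemma polynomials_in_diff:
  "p \<in> polynomials_in Z \<Longrightarrow> q \<in> polynomials_in Z \<Longrightarrow> p - q \<in> polynomials_in Z"
  using Poly_Mapping.keys_diff[of p q] by (fastforce simp: polynomials_in_def)

lemma polynomials_in_mult:
  assumes "p \<in> polynomials_in Z" "q \<in> polynomials_in Z"
  shows "p * q \<in> polynomials_in Z"
proof -
  have "Poly_Mapping.keys m \<subseteq> Z" if m: "m \<in> Poly_Mapping.keys (p * q)" for m
  proof -
    obtain a b where "m = a + b" "a \<in> Poly_Mapping.keys p" "b \<in> Poly_Mapping.keys q"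
      using m keys_mult[of p q] by blast
    then show ?thesis
      using assms Poly_Mapping.keys_add[of a b] unfolding polynomials_in_def by blast
  qed
  then show ?thesis
    by (simp add: polynomials_in_def)
qed

lemma polynomials_in_power: "p \<in> polynomials_in Z \<Longrightarrow> p ^ n \<in> polynomials_in Z"
  by (induction n) (simp_all add: polynomials_in_mult)

lemma polynomials_in_sum:
  "(\<And>x. x \<in> A \<Longrightarrow> f x \<in> polynomials_in Z) \<Longrightarrow> sum f A \<in> polynomials_in Z"
  by (induction A rule: infinite_finite_induct) (simp_all add: polynomials_in_add)

lemma polynomials_in_prod:
  "(\<And>x. x \<in> A \<Longrightarrow> f x \<in> polynomials_in Z) \<Longrightarrow> prod f A \<in> polynomials_in Z"
  by (induction A rule: infinite_finite_induct) (simp_all add: polynomials_in_mult)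

lemma subst_in_polynomials_in:
  assumes "p \<in> polynomials_in Z" "\<And>z. z \<in> Z \<Longrightarrow> g z \<in> polynomials_in Y"
  shows "subst g p \<in> polynomials_in Y"
  unfolding subst_def scale_def using assms
  by (intro polynomials_in_sum polynomials_in_mult polynomials_in_prod polynomials_in_power)
    (auto simp: polynomials_in_def[of Z])

text \<open>By \<open>subst_subst\<close>, a permutation of \<open>Y\<close> acts on the result only
  through the polynomials \<open>g z\<close>, and it fixes each of them.\<close>

lemma subst_in_sym_polynomials:
  assumes p: "p \<in> polynomials_in Z" and g: "\<And>z. z \<in> Z \<Longrightarrow> g z \<in> sym_polynomials Y"
  shows "subst g p \<in> sym_polynomials Y"
proof -
  have "subst (\<lambda>z. indet (\<sigma> z)) (subst g p) = subst g p" if "\<sigma> permutes Y" for \<sigma>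
    unfolding subst_subst by (rule subst_cong[OF p]) (use g that in \<open>auto simp: sym_polynomials_def\<close>)
  then show ?thesis
    using subst_in_polynomials_in[OF p] g by (simp add: sym_polynomials_def)
qed

text \<open>A permutation of \<open>Y\<close> merely reorders the factors.\<close>

lemma prod_const_minus_indet_in_sym_polynomials:
  "(\<Prod>w\<in>Y. const c - indet w) \<in> sym_polynomials Y"
proof -
  have "subst (\<lambda>z. indet (\<sigma> z)) (\<Prod>w\<in>Y. const c - indet w) = (\<Prod>w\<in>Y. const c - indet w)"
    if "\<sigma> permutes Y" for \<sigma>
    by (simp add: subst_prod subst_diff prod.permute[OF that, symmetric, unfolded o_def,
        of "\<lambda>w. const c - indet w"])
  then show ?thesis
    by (simp add: sym_polynomials_def polynomials_in_prod polynomials_in_diff polynomials_in_indet)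
qed

section \<open>Polynomials vanishing at all complex points\<close>

text \<open>
  As in Dedekind's lemma on characters: doubling the coordinate \<open>z\<close> multiplies \<open>mon c m\<close> by
  \<open>2 ^ lookup m z\<close>, so a suitable combination of a relation with its rescaling is shorter.
\<close>

lemma mon_independent:
  fixes b :: "('v \<Rightarrow>\<^sub>0 nat) \<Rightarrow> complex"
  assumes "finite M" "\<And>c. (\<Sum>m\<in>M. b m * mon c m) = 0"
  shows "\<forall>m\<in>M. b m = 0"
  using assms
proof (induction M arbitrary: b rule: finite_induct)
  case empty
  then show ?case by simp
next
  case (insert m0 M)
  have scaled: "mon (c(z := 2 * c z)) m = 2 ^ Poly_Mapping.lookup m z * mon c m"
    for c :: "'v \<Rightarrow> complex" and z m
  proof -
    \<comment> \<open>The variable \<open>z\<close> need not occur in \<open>m\<close>; adding it to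
      the index set treats both cases at once.\<close>
    let ?Z = "insert z (Poly_Mapping.keys m)"
    have "mon (c(z := 2 * c z)) m =
        (\<Prod>w\<in>?Z. (if w = z then 2 ^ Poly_Mapping.lookup m z else 1) * c w ^ Poly_Mapping.lookup m w)"
      by (subst mon_superset[of ?Z], simp, blast, rule prod.cong) (auto simp: power_mult_distrib)
    also have "\<dots> = 2 ^ Poly_Mapping.lookup m z * mon c m"
      by (simp only: prod.distrib mon_superset[of ?Z m c, OF finite.insertI[OF finite_keys] subset_insertI])
        (simp add: prod.delta)
    finally show ?thesis .
  qed
  have coeff: "b m * (2 ^ Poly_Mapping.lookup m z - 2 ^ Poly_Mapping.lookup m0 z) = 0"
    if "m \<in> M" for m z
  proof -
    have "(\<Sum>m\<in>M. b m * (2 ^ Poly_Mapping.lookup m z - 2 ^ Poly_Mapping.lookup m0 z) * mon c m) = 0"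
      (is "?S = 0") for c
    proof -
      \<comment> \<open>The \<open>m0\<close> terms cancel, which leaves a relation over
        \<open>M\<close> alone for the induction hypothesis.\<close>
      have "?S = (\<Sum>m\<in>insert m0 M. b m * mon (c(z := 2 * c z)) m)
          - 2 ^ Poly_Mapping.lookup m0 z * (\<Sum>m\<in>insert m0 M. b m * mon c m)"
        using insert.hyps unfolding scaled
        by (simp add: sum_distrib_left sum_subtractf algebra_simps)
      then show ?thesis
        by (simp only: insert.prems) simp
    qed
    from insert.IH[OF this] that show ?thesis by blast
  qed
  have M: "b m = 0" if "m \<in> M" for m
  proof -
    have "m \<noteq> m0" using that insert.hyps by blast
    then obtain z where "Poly_Mapping.lookup m z \<noteq> Poly_Mapping.lookup m0 z"
      by (metis poly_mapping_eqI)
    \<comment> \<open>Distinct exponents give distinct powers of 2 in the naturals, and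
      \<open>of_nat\<close> carries this over to the complex numbers.\<close>
    then have "(of_nat (2 ^ Poly_Mapping.lookup m z) :: complex) \<noteq> of_nat (2 ^ Poly_Mapping.lookup m0 z)"
      by (subst of_nat_eq_iff) simp
    then show ?thesis
      using coeff[OF that, of z] by simp
  qed
  \<comment> \<open>With all other coefficients zero, the relation at the all-ones point reads
    \<open>b m0 = 0\<close>.\<close>
  have "mon (\<lambda>_. 1) m0 = (1::complex)"
    by (simp add: mon_def)
  then have "b m0 = 0"
    using insert.prems[of "\<lambda>_. 1"] insert.hyps M by simp
  then show ?case using M by simp
qed

lemma subst_const_eq:
  "subst (\<lambda>z. const (c z)) p =
     const (\<Sum>m\<in>Poly_Mapping.keys p. Poly_Mapping.lookup p m * mon c m)"
  by (simp add: subst_eq_mon const_sum const_mult mon_def const_prod const_power)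

lemma cpoly_eq_0I:
  assumes "\<And>c. subst (\<lambda>z. const (c z)) p = 0"
  shows "p = 0"
proof -
  have "\<forall>m\<in>Poly_Mapping.keys p. Poly_Mapping.lookup p m = 0"
    by (rule mon_independent) (use assms in \<open>auto simp: subst_const_eq\<close>)
  then show ?thesis
    by (metis in_keys_iff poly_mapping_eqI lookup_zero)
qed

section \<open>Monic polynomials with prescribed values\<close>

text \<open>Newton's scheme: a new node is served by adding a multiple of the polynomial
  \<open>N\<close> that vanishes at the old ones. The degree bound is one above the sharp one for
  nonempty \<open>Z\<close>, which avoids subtraction and still lies below \<open>card Y\<close>
  later.\<close>

lemma interpolation:
  fixes h c :: "'a \<Rightarrow> 'b::field"
  assumes "finite Z" "inj_on h Z"
  shows "\<exists>P. degree P \<le> card Z \<and> (\<forall>z\<in>Z. poly P (h z) = c z)"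
  using assms
proof (induction Z rule: finite_induct)
  case empty
  show ?case by (intro exI[of _ 0]) simp
next
  case (insert y Z)
  then obtain P where P: "degree P \<le> card Z" "\<forall>z\<in>Z. poly P (h z) = c z"
    by auto
  define N where "N = (\<Prod>z\<in>Z. [:- h z, 1:])"
  have degN: "degree N = card Z"
    using insert.hyps by (simp add: N_def degree_prod_eq_sum_degree)
  have N0: "poly N (h y) \<noteq> 0"
    using insert by (auto simp: N_def poly_prod)
  have N: "poly N (h z) = 0" if "z \<in> Z" for z
    using insert.hyps that by (auto simp: N_def poly_prod)
  define Q where "Q = P + smult ((c y - poly P (h y)) / poly N (h y)) N"
  have "degree Q \<le> card Z"
    unfolding Q_def using P(1) degN
    by (intro degree_add_le) (auto intro: order.trans[OF degree_smult_le])
  moreover have "\<forall>z\<in>insert y Z. poly Q (h z) = c z"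
    using P(2) N N0 by (auto simp: Q_def)
  ultimately show ?case
    using insert.hyps by (intro exI[of _ Q]) auto
qed

text \<open>Each element of \<open>Y\<close> indexes one root, split off by the fundamental theorem
  of algebra; repeated roots are allowed.\<close>

lemma monic_factorization:
  fixes P :: "complex poly"
  assumes "finite Y" "degree P = card Y" "lead_coeff P = 1"
  shows "\<exists>a. P = (\<Prod>w\<in>Y. [:- a w, 1:])"
  using assms
proof (induction Y arbitrary: P rule: finite_induct)
  case empty
  then show ?case by (auto elim!: degree_eq_zeroE)
next
  case (insert y Y)
  then have "degree P \<noteq> 0" by simp
  then obtain r where "poly P r = 0"
    using fundamental_theorem_of_algebra constant_degree by metis
  then obtain Q where Q: "P = [:- r, 1:] * Q"
    by (metis dvdE poly_eq_0_iff_dvd)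
  then have "Q \<noteq> 0" using insert.prems by auto
  then have "degree P = Suc (degree Q)" "lead_coeff P = lead_coeff Q"
    unfolding Q by (subst degree_mult_eq; simp) (simp only: lead_coeff_mult, simp)
  then obtain a where "Q = (\<Prod>w\<in>Y. [:- a w, 1:])"
    using insert.IH[of Q] insert.prems insert.hyps by auto
  also have "\<dots> = (\<Prod>w\<in>Y. [:- (a(y := r)) w, 1:])"
    by (rule prod.cong) (use insert.hyps in auto)
  finally have "P = (\<Prod>w\<in>insert y Y. [:- (a(y := r)) w, 1:])"
    by (simp only: Q prod.insert[OF insert.hyps] fun_upd_same)
  then show ?case by blast
qed

text \<open>The numbers \<open>a w\<close> are the roots of a monic polynomial of degree
  \<open>card Y\<close> taking the value \<open>c z\<close> at \<open>h z\<close>.\<close>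

lemma ex_prod_diff_eq:
  fixes h c :: "'a \<Rightarrow> complex"
  assumes "finite Z" "inj_on h Z" "finite Y" "card Z < card Y"
  shows "\<exists>a. \<forall>z\<in>Z. (\<Prod>w\<in>Y. h z - a w) = c z"
proof -
  obtain R where R: "degree R \<le> card Z" "\<forall>z\<in>Z. poly R (h z) = c z"
    using interpolation[OF assms(1,2)] by blast
  \<comment> \<open>Monic of degree \<open>card Y\<close> and zero at every node: adding
    \<open>N\<close> to \<open>R\<close> keeps the prescribed values, and since \<open>R\<close> has
    smaller degree the sum is monic.\<close>
  define N where "N = (\<Prod>z\<in>Z. [:- h z, 1:]) * monom 1 (card Y - card Z)"
  have N0: "(\<Prod>z\<in>Z. [:- h z, 1:]) \<noteq> 0"
    using assms(1) by auto
  have degN: "degree N = card Y"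
    unfolding N_def using assms N0
    by (subst degree_mult_eq) (auto simp: degree_prod_eq_sum_degree degree_monom_eq)
  have leadN: "lead_coeff N = 1"
    unfolding N_def by (simp add: lead_coeff_mult lead_coeff_prod degree_monom_eq)
  have less: "degree R < degree N"
    using R(1) degN assms(4) by simp
  have "degree (R + N) = card Y" "lead_coeff (R + N) = 1"
    using less degN leadN by (simp_all add: degree_add_eq_right coeff_eq_0)
  then obtain a where a: "R + N = (\<Prod>w\<in>Y. [:- a w, 1:])"
    using monic_factorization[OF assms(3)] by blast
  have "(\<Prod>w\<in>Y. h z - a w) = c z" if "z \<in> Z" for z
  proof -
    have "poly (R + N) (h z) = c z"
      using R(2) that assms(1) by (auto simp: N_def poly_prod)
    then show ?thesis
      unfolding a by (simp add: poly_prod)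
  qed
  then show ?thesis by blast
qed

section \<open>The embedding\<close>

text \<open>Evaluating the relation at suitable roots \<open>a\<close> gives the value of
  \<open>p\<close> at an arbitrary point \<open>c\<close>, so \<open>p\<close> vanishes
  everywhere.\<close>

lemma subst_prod_const_minus_indet_eq_0D:
  assumes "finite Z" "inj_on h Z" "finite Y" "card Z < card Y" and p: "p \<in> polynomials_in Z"
    and 0: "subst (\<lambda>z. \<Prod>w\<in>Y. const (h z) - indet w) p = 0"
  shows "p = 0"
proof (rule cpoly_eq_0I)
  fix c
  obtain a where a: "\<forall>z\<in>Z. (\<Prod>w\<in>Y. h z - a w) = c z"
    using ex_prod_diff_eq[OF assms(1-4)] by blast
  have "subst (\<lambda>z. const (c z)) p = subst (\<lambda>z. const (\<Prod>w\<in>Y. h z - a w)) p"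
    by (rule subst_cong[OF p]) (simp add: a)
  also have "\<dots> = subst (\<lambda>w. const (a w)) (subst (\<lambda>z. \<Prod>w\<in>Y. const (h z) - indet w) p)"
    by (simp add: subst_subst subst_prod subst_diff const_prod const_diff)
  finally show "subst (\<lambda>z. const (c z)) p = 0"
    by (simp add: 0)
qed

lemma algebra_monomorphic_sym_polynomials:
  fixes Z Y :: "'v set"
  assumes "finite Z" "finite Y" "card Z < card Y"
  shows "algebra_monomorphic (sym_polynomials Z) (sym_polynomials Y)"
proof -
  \<comment> \<open>An injective numbering of \<open>Z\<close> supplies distinct complex
    nodes.\<close>
  obtain f :: "'v \<Rightarrow> nat" where "inj_on f Z"
    using finite_imp_inj_to_nat_seg[OF assms(1)] by blast
  then have h: "inj_on (\<lambda>z. of_nat (f z) :: complex) Z"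
    by (simp add: inj_on_def)
  define g where "g = (\<lambda>z. \<Prod>w\<in>Y. const (of_nat (f z)) - indet w)"
  have "algebra_hom_on (sym_polynomials Z) (sym_polynomials Y) (subst g)"
    unfolding algebra_hom_on_def
    by (auto simp: subst_add subst_mult subst_scale sym_polynomials_def[of Z] g_def
        intro!: subst_in_sym_polynomials prod_const_minus_indet_in_sym_polynomials)
  moreover have "inj_on (subst g) (sym_polynomials Z)"
  proof (rule inj_onI)
    fix p q assume "p \<in> sym_polynomials Z" "q \<in> sym_polynomials Z" "subst g p = subst g q"
    then have "p - q \<in> polynomials_in Z" "subst g (p - q) = 0"
      by (simp_all add: sym_polynomials_def polynomials_in_diff subst_diff)
    then have "p - q = 0"
      unfolding g_def by (rule subst_prod_const_minus_indet_eq_0D[OF assms(1) h assms(2,3)])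
    then show "p = q" by simp
  qed
  ultimately show ?thesis
    unfolding algebra_monomorphic_def by blast
qed

theorem corollary3p4:
  fixes n0 :: nat and x :: "nat \<Rightarrow> 'v" and y :: 'v
  assumes "inj_on x {1..n0}" and "y \<notin> x ` {1..n0}"
  shows "algebra_monomorphic (sym_polynomials (x ` {1..n0}))
           (sym_polynomials (insert y (x ` {1..n0})))"
  \<comment> \<open>As \<open>y\<close> is new, adjoining it raises the cardinality by one, hence
    strictly.\<close>
  by (rule algebra_monomorphic_sym_polynomials) (use assms(2) in simp_all)

end
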